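(* Let $t \ge 3$ be an integer and let $g$ denote the Sprague-Grundy function of the game \textsc{Mark}-$t$ in normal play. For every $k \in \{0,1,\ldots,t-2\}$ and every nonnegative integer $n$, we have $g(n) = k$ if and only if the base-$t$ representation $R(n)$ of $n$ ends with an odd number of trailing digits equal to $k$.
   Context: \textsc{Mark}-$t$ (for an integer $t\ge 2$) is the impartial game whose positions are the nonnegative integers; from a position $n \ge 1$ a move goes to any of $n-1, n-2, \ldots, n-(t-1)$ that is nonnegative, or to $\lfloor n/t \rfloor$; the position $0$ has no moves. In normal play the player unable to move loses. The Sprague-Grundy function is defined recursively by $g(n) = \operatorname{mex}\{g(m) : m \text{ an option of } n\}$, where $\operatorname{mex} S$ is the least nonnegative integer not in $S$. $R(n)$ denotes the usual base-$t$ representation of $n$ (without leading zeros, with $R(0)$ the single digit $0$). "The number of trailing $k$'s" of $R(n)$ is the length of the maximal final block of $R(n)$ consisting of the digit $k$. *)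

theory Defs
  imports Main
begin

definition mex :: "nat set \<Rightarrow> nat" where
  "mex S = (LEAST m. m \<notin> S)"

definition mark_moves :: "nat \<Rightarrow> nat \<Rightarrow> nat set" where
  "mark_moves t n =
     (if n = 0 then {} else {n - i | i. 1 \<le> i \<and> i \<le> t - 1 \<and> i \<le> n} \<union> {n div t})"

lemma mark_moves_less: "t \<ge> 2 \<Longrightarrow> m \<in> mark_moves t n \<Longrightarrow> m < n"
  by (auto simp: mark_moves_def split: if_splits)

text \<open>The case \<open>t < 2\<close> is a dummy value that only serves to make the function total
  (for \<open>t = 1\<close> the move to \<open>n div t\<close> would not decrease the position).\<close>

function mark_grundy :: "nat \<Rightarrow> nat \<Rightarrow> nat" where
  "mark_grundy t n = (if t < 2 then 0 else mex (mark_grundy t ` mark_moves t n))"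
  by pat_completeness auto
termination
  by (relation "measure snd") (auto dest: mark_moves_less[rotated])

declare mark_grundy.simps [simp del]

lemma mark_grundy_rec:
  "t \<ge> 2 \<Longrightarrow> mark_grundy t n = mex (mark_grundy t ` mark_moves t n)"
  by (subst mark_grundy.simps) simp

text \<open>Base-\<open>t\<close> digits, most significant digit first; bases \<open>t < 2\<close> are dummy cases.\<close>

function base_repr :: "nat \<Rightarrow> nat \<Rightarrow> nat list" where
  "base_repr t n = (if t < 2 \<or> n < t then [n] else base_repr t (n div t) @ [n mod t])"
  by pat_completeness auto
termination
  by (relation "measure snd") auto

declare base_repr.simps [simp del]

lemma base_repr_value: "horner_sum id t (rev (base_repr t n)) = n"
proof (induction t n rule: base_repr.induct)
  case (1 t n)
  then show ?case by (subst base_repr.simps) (auto simp: id_def)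
qed

lemma base_repr_digits: "t \<ge> 2 \<Longrightarrow> d \<in> set (base_repr t n) \<Longrightarrow> d < t"
proof (induction t n rule: base_repr.induct)
  case (1 t n)
  from 1(3) show ?case
    by (subst (asm) base_repr.simps) (use 1(1,2) in \<open>auto split: if_splits\<close>)
qed

lemma base_repr_nonempty: "base_repr t n \<noteq> []"
  by (subst base_repr.simps) simp

lemma base_repr_0: "base_repr t 0 = [0]"
  by (subst base_repr.simps) auto

lemma base_repr_no_leading_zero: "n > 0 \<Longrightarrow> hd (base_repr t n) \<noteq> 0"
proof (induction t n rule: base_repr.induct)
  case (1 t n)
  show ?case
  proof (cases "t < 2 \<or> n < t")
    case True
    with 1(2) show ?thesis by (subst base_repr.simps) simp
  next
    case False
    then have "n div t > 0" by (simp add: div_greater_zero_iff)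
    with 1(1)[OF False] False show ?thesis
      by (subst base_repr.simps) (simp add: base_repr_nonempty)
  qed
qed

definition trailing :: "'a \<Rightarrow> 'a list \<Rightarrow> nat" where
  "trailing k ds = length (takeWhile (\<lambda>d. d = k) (rev ds))"

end

theory Submission
  imports Defs
begin

text \<open>Write \<open>n = q t + r\<close> with \<open>r < t\<close>. Moving down by at most \<open>t - 1\<close> never preserves the residue \<open>r\<close>,
  so inductively the value \<open>r\<close> can only be seen through the option \<open>q\<close>; all smaller values are
  supplied by the block of \<open>n\<close> (with \<open>q\<close> filling the gap at \<open>g(q)\<close>). Hence for \<open>k \<le> t - 2\<close> one has
  \<open>g(n) = k\<close> iff \<open>r = k\<close> and (\<open>n = 0\<close> or \<open>g(q) \<noteq> k\<close>), and removing the last digit flips the parity of the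
  number of trailing \<open>k\<close>'s in the same way. If \<open>g(q) = r\<close>, the values between \<open>r\<close> and \<open>t - 1\<close> come from
  the previous block, whose gap at \<open>g(q - 1)\<close> is harmless as \<open>q - 1\<close> and \<open>q\<close> have consecutive residues.\<close>

lemma mex_notin:
  assumes "finite S"
  shows "mex S \<notin> S"
proof -
  obtain m where "m \<notin> S"
    using assms ex_new_if_finite infinite_UNIV_nat by blast
  then show ?thesis
    unfolding mex_def by (rule LeastI)
qed

lemma mex_eqI: "\<lbrakk>k \<notin> S; \<And>j. j < k \<Longrightarrow> j \<in> S\<rbrakk> \<Longrightarrow> mex S = k"
  unfolding mex_def by (rule Least_equality) (auto intro: leI)

lemma finite_mark_moves: "t \<ge> 2 \<Longrightarrow> finite (mark_moves t n)"
  by (rule finite_subset[of _ "{..<n}"]) (auto dest: mark_moves_less)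

lemma mark_moves_subtract: "\<lbrakk>m < n; n \<le> m + (t - 1)\<rbrakk> \<Longrightarrow> m \<in> mark_moves t n"
  by (auto simp: mark_moves_def intro!: exI[of _ "n - m"])

lemma mark_moves_div: "n > 0 \<Longrightarrow> n div t \<in> mark_moves t n"
  by (simp add: mark_moves_def)

lemma mark_moves_cases:
  assumes "m \<in> mark_moves t n"
  obtains "m = n div t" | "m < n" "n \<le> m + (t - 1)"
  using assms by (auto simp: mark_moves_def split: if_splits)

lemma mark_grundy_0: "t \<ge> 2 \<Longrightarrow> mark_grundy t 0 = 0"
  by (subst mark_grundy_rec) (simp_all add: mark_moves_def mex_def)

lemma mod_neq_if_close:
  fixes m n t :: nat
  assumes "m < n" "n \<le> m + (t - 1)"
  shows "m mod t \<noteq> n mod t"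
proof
  assume "m mod t = n mod t"
  then have "t dvd n - m"
    using assms by (metis mod_eq_dvd_iff_nat less_imp_le_nat)
  then show False
    using assms by (auto dest!: dvd_imp_le)
qed

lemma mark_grundy_eq_iff:
  assumes "t \<ge> 3" and "k < t - 1"
  shows "mark_grundy t n = k \<longleftrightarrow> n mod t = k \<and> (n = 0 \<or> mark_grundy t (n div t) \<noteq> k)"
  using assms(2)
\<comment> \<open>Deciding whether \<open>k\<close> is the mex requires knowing which other values
  occur among the options, so \<open>k\<close> must vary in the induction hypothesis.\<close>
proof (induction n arbitrary: k rule: less_induct)
  case (less n)
  define g where "g = mark_grundy t"
  have IH: "g m = j \<longleftrightarrow> m mod t = j \<and> (m = 0 \<or> g (m div t) \<noteq> j)"
    if "m < n" "j < t - 1" for m j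
    using less.IH that unfolding g_def by blast
  show ?case
  proof (cases "n = 0")
    case True
    then show ?thesis using assms by (simp add: mark_grundy_0)
  next
    case False
    define q r where "q = n div t" and "r = n mod t"
    define S where "S = g ` mark_moves t n"
    have n: "n = q * t + r" and "r < t" and "q < n"
      using assms False by (auto simp: q_def r_def)
    have gn: "g n = mex S" and "finite S"
      using assms by (auto simp: g_def S_def finite_mark_moves intro!: mark_grundy_rec)
    have gq: "g q \<in> S"
      using False by (auto simp: S_def q_def mark_moves_div)
    have below: "j \<in> S" if "j < r" for j
    proof (cases "g q = j")
      case True
      then show ?thesis using gq by simp
    next
      case neq: False
      have "g (q * t + j) = j"
        using IH[of "q * t + j" j] that neq n \<open>r < t\<close> by simp
      moreover have "q * t + j \<in> mark_moves t n"
        using n that \<open>r < t\<close> by (intro mark_moves_subtract) auto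
      ultimately show ?thesis unfolding S_def by force
    qed
    have r_notin: "r \<notin> S" if "r < t - 1" "g q \<noteq> r"
    proof
      assume "r \<in> S"
      then obtain m where m: "m \<in> mark_moves t n" "g m = r"
        by (auto simp: S_def)
      from m(1) show False
      proof (cases rule: mark_moves_cases)
        case 1
        then show False using m that by (simp add: q_def)
      next
        case 2
        then show False
          using IH[of m r] m that mod_neq_if_close[of m n t] by (simp add: r_def)
      qed
    qed
    have all_in: "j \<in> S" if "g q = r \<or> r = t - 1" "j < t - 1" for j
    proof (cases j r rule: linorder_cases)
      case less
      then show ?thesis by (rule below)
    next
      case equal
      then show ?thesis using that gq by auto
    next
      case greater
      then have gqr: "g q = r" "r < t - 1" using that by auto
      have "q \<noteq> 0"
      proof
        assume "q = 0"
        then have "r = 0" using gqr assms by (simp add: g_def mark_grundy_0)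
        with \<open>q = 0\<close> n False show False by simp
      qed
      then obtain p where p: "q = Suc p" by (cases q) auto
      \<comment> \<open>Since \<open>j < t - 1\<close>, adding 1 to \<open>p\<close> cannot wrap
        around: \<open>q\<close> would have residue \<open>j + 1 > r\<close>, whereas
        \<open>g q = r\<close> forces residue \<open>r\<close>.\<close>
      have "g p \<noteq> j"
      proof
        assume "g p = j"
        then have "p mod t = j" using IH[of p j] p \<open>q < n\<close> that by simp
        then have "q mod t = Suc j" using p that by (simp add: mod_Suc)
        moreover have "q mod t = r" using IH[of q r] \<open>q < n\<close> gqr by simp
        ultimately show False using greater by simp
      qed
      then have "g (p * t + j) = j"
        using IH[of "p * t + j" j] n p that by simp
      \<comment> \<open>Within reach: the distance from \<open>n\<close> is
        \<open>t + r - j\<close>, at most \<open>t - 1\<close> because \<open>j > r\<close>.\<close>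
      moreover have "p * t + j \<in> mark_moves t n"
        using n p that greater by (intro mark_moves_subtract) auto
      ultimately show ?thesis unfolding S_def by force
    qed
    have "mex S = k \<longleftrightarrow> r = k \<and> g q \<noteq> k"
    proof (cases "g q = r \<or> r = t - 1")
      case True
      \<comment> \<open>Here \<open>S\<close> contains every value below \<open>t - 1\<close>, so
        both sides of the equivalence are false.\<close>
      then have "mex S \<noteq> k"
        using all_in[OF True less.prems] mex_notin[OF \<open>finite S\<close>] by metis
      then show ?thesis using True less.prems by auto
    next
      case False
      then have "r < t - 1" using \<open>r < t\<close> by linarith
      then have "mex S = r"
        using False below r_notin by (intro mex_eqI) auto
      then show ?thesis using False by auto
    qed
    then show ?thesis
      using gn False by (simp add: g_def q_def r_def)
  qed
qed

lemma trailing_snoc: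
  "trailing k (ds @ [d]) = (if d = k then Suc (trailing k ds) else 0)"
  by (simp add: trailing_def)

theorem theorem1:
  fixes t k n :: nat
  assumes "t \<ge> 3" and "k \<in> {0..t - 2}"
  shows "mark_grundy t n = k \<longleftrightarrow> odd (trailing k (base_repr t n))"
proof (induction n rule: less_induct)
  case (less n)
  have k: "k < t - 1" using assms by auto
  note rec = mark_grundy_eq_iff[OF assms(1) k, of n]
  show ?case
  proof (cases "n < t")
    case True
    then have "base_repr t n = [n]" by (subst base_repr.simps) simp
    \<comment> \<open>The representation \<open>[0]\<close> has one trailing 0, matching the value 0
      at position 0. For \<open>0 < n < t\<close> the quotient is 0, whose value 0 differs from the
      digit \<open>n\<close>.\<close>
    then show ?thesis
      using rec True assms by (auto simp: trailing_def mark_grundy_0)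
  next
    case False
    then have "base_repr t n = base_repr t (n div t) @ [n mod t]"
      using assms by (subst base_repr.simps) simp
    moreover have "n div t < n" using False assms by simp
    ultimately show ?thesis
      using rec less.IH[of "n div t"] False assms by (auto simp: trailing_snoc)
  qed
qed

end
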